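(* Let $N\ge1$, $1<p<\infty$ and $0<s<1$. Let $\Omega\subset\mathbb{R}^N$ be a bounded domain with Lipschitz boundary, and suppose that $sp>N$. Define $\beta:=s-\frac Np\in(0,1)$. Then the space $W^{s+\log,p}_0(\Omega)$ is continuously embedded into the Hölder space $C^{0,\beta}(\overline\Omega)$.
   Context: $W^{s+\log,p}_0(\Omega)$ is the space of real-valued $u\in L^p(\mathbb{R}^N)$ with $u=0$ a.e. in $\mathbb{R}^N\setminus\Omega$ and finite norm $$\|u\|_{W^{s+\log,p}_0(\Omega)}:=\left(\iint_{\mathbb{R}^{2N}}|u(x)-u(y)|^p\,\mathbf{k}^{s+\log,+}_p(x-y)\,dx\,dy\right)^{1/p},\qquad\mathbf{k}^{s+\log,+}_p(z)=\frac{C(N,s,p)(-\ln|z|)_+}{|z|^{N+sp}},$$ where $(a)_+=\max\{0,a\}$ and $$C(N,s,p)=\begin{cases}\dfrac{s\,p\,2^{2(s-1)}\,\Gamma\left(\frac{N+sp}{2}\right)}{\pi^{\frac{N-1}{2}}\,\Gamma(1-s)\,\Gamma\left(\frac{p+1}{2}\right)}, & s>\tfrac12,\\[8pt]\dfrac{s\,p\,2^{2s-1}\,\Gamma\left(\frac{N+sp}{2}\right)}{\pi^{\frac N2}\,\Gamma(1-s)}, & s\le\tfrac12.\end{cases}$$ $C^{0,\beta}(\overline\Omega)$ carries the norm $\|u\|_{C^{0,\beta}(\overline\Omega)}=\|u\|_{L^\infty(\Omega)}+\sup_{x\ne y\in\Omega}\frac{|u(x)-u(y)|}{|x-y|^\beta}$;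 functions are identified with their continuous representatives. *)

theory Defs
  imports "HOL-Probability.Probability"
begin

definition is_domain :: "'a::euclidean_space set \<Rightarrow> bool" where
  "is_domain \<Omega> \<longleftrightarrow> open \<Omega> \<and> connected \<Omega> \<and> \<Omega> \<noteq> {}"

text \<open>
  Near every boundary point, \<open>\<Omega>\<close> is the strict epigraph of a Lipschitz function \<open>\<gamma>\<close> of the
  \<open>N - 1\<close> remaining variables in some orthonormal coordinate system. The last coordinate axis is
  given by the unit vector \<open>e\<close>, and \<open>\<gamma>\<close> is a function on the hyperplane orthogonal to \<open>e\<close>
  (a single point if \<open>N = 1\<close>).
\<close>
definition Lipschitz_boundary :: "'a::euclidean_space set \<Rightarrow> bool" where
  "Lipschitz_boundary \<Omega> \<longleftrightarrow>
     (\<forall>x0\<in>frontier \<Omega>. \<exists>r>0. \<exists>e. \<exists>\<gamma>::'a \<Rightarrow> real. \<exists>L.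
        norm e = 1 \<and> L-lipschitz_on {y. y \<bullet> e = 0} \<gamma> \<and>
        \<Omega> \<inter> ball x0 r = {x \<in> ball x0 r. \<gamma> (x - (x \<bullet> e) *\<^sub>R e) < x \<bullet> e})"

definition kernel_const :: "nat \<Rightarrow> real \<Rightarrow> real \<Rightarrow> real" where
  "kernel_const N s p =
     (if s > 1/2
      then s * p * 2 powr (2 * (s - 1)) * Gamma ((real N + s * p) / 2) /
           (pi powr ((real N - 1) / 2) * Gamma (1 - s) * Gamma ((p + 1) / 2))
      else s * p * 2 powr (2 * s - 1) * Gamma ((real N + s * p) / 2) /
           (pi powr (real N / 2) * Gamma (1 - s)))"

text \<open>The value at \<open>z = 0\<close> is irrelevant, the diagonal being a null set.\<close>
definition log_kernel :: "real \<Rightarrow> real \<Rightarrow> 'a::euclidean_space \<Rightarrow> real" where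
  "log_kernel s p z =
     kernel_const DIM('a) s p * max 0 (- ln (norm z)) / norm z powr (real DIM('a) + s * p)"

definition W_energy :: "real \<Rightarrow> real \<Rightarrow> ('a::euclidean_space \<Rightarrow> real) \<Rightarrow> ennreal" where
  "W_energy s p u =
     (\<integral>\<^sup>+(x, y). ennreal (\<bar>u x - u y\<bar> powr p * log_kernel s p (x - y)) \<partial>(lebesgue :: ('a \<times> 'a) measure))"

definition W_norm :: "real \<Rightarrow> real \<Rightarrow> ('a::euclidean_space \<Rightarrow> real) \<Rightarrow> real" where
  "W_norm s p u = enn2real (W_energy s p u) powr (1 / p)"

text \<open>
  Elements of function spaces are represented by functions rather than by classes modulo equality
  almost everywhere. The first two conditions say \<open>u \<in> L\<^sup>p\<close>.
\<close>
definition W_space :: "real \<Rightarrow> real \<Rightarrow> 'a::euclidean_space set \<Rightarrow> ('a \<Rightarrow> real) set" where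
  "W_space s p \<Omega> =
     {u. u \<in> borel_measurable lebesgue \<and> integrable lebesgue (\<lambda>x. \<bar>u x\<bar> powr p) \<and>
         (AE x in lebesgue. x \<notin> \<Omega> \<longrightarrow> u x = 0) \<and> W_energy s p u < \<infinity>}"

definition Holder_norm :: "real \<Rightarrow> 'a::euclidean_space set \<Rightarrow> ('a \<Rightarrow> real) \<Rightarrow> ennreal" where
  "Holder_norm \<beta> \<Omega> v =
     esssup (lebesgue_on \<Omega>) (\<lambda>x. ennreal \<bar>v x\<bar>) +
     (SUP (x, y)\<in>{(x, y). x \<in> \<Omega> \<and> y \<in> \<Omega> \<and> x \<noteq> y}. ennreal (\<bar>v x - v y\<bar> / norm (x - y) powr \<beta>))"

text \<open>Only the values on \<open>closure \<Omega>\<close> of a member of this set are significant.\<close>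
definition Holder_space :: "real \<Rightarrow> 'a::euclidean_space set \<Rightarrow> ('a \<Rightarrow> real) set" where
  "Holder_space \<beta> \<Omega> = {v. continuous_on (closure \<Omega>) v \<and> Holder_norm \<beta> \<Omega> v < \<infinity>}"

text \<open>
  Continuous embedding of a space \<open>X\<close> of functions (modulo null sets) with norm \<open>normX\<close> into a space
  \<open>Y\<close> of functions with norm \<open>normY\<close>: every \<open>u \<in> X\<close> agrees almost everywhere on \<open>\<Omega>\<close> with some
  \<open>v \<in> Y\<close>, and the norm of \<open>v\<close> is at most that of \<open>u\<close> times a constant not depending on \<open>u\<close>.
  For \<open>\<Omega>\<close> open and \<open>Y\<close> consisting of functions continuous on \<open>closure \<Omega>\<close>, the representative \<open>v\<close>
  is unique on \<open>closure \<Omega>\<close>.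
\<close>
definition continuously_embedded ::
  "'a::euclidean_space set \<Rightarrow> ('a \<Rightarrow> real) set \<Rightarrow> (('a \<Rightarrow> real) \<Rightarrow> real) \<Rightarrow>
   ('a \<Rightarrow> real) set \<Rightarrow> (('a \<Rightarrow> real) \<Rightarrow> ennreal) \<Rightarrow> bool" where
  "continuously_embedded \<Omega> X normX Y normY \<longleftrightarrow>
     (\<exists>C::real. C \<ge> 0 \<and>
        (\<forall>u\<in>X. \<exists>v\<in>Y. (AE x in lebesgue. x \<in> \<Omega> \<longrightarrow> u x = v x) \<and> normY v \<le> ennreal (C * normX u)))"

end

theory Submission
  imports Defs
begin

text \<open>
  The proof is Campanato's argument. Write \<open>N\<close> for the dimension and \<open>E\<close> for the energy of \<open>u\<close>.
  At distances \<open>\<bar>z\<bar> \<le> d \<le> 1/2\<close> the factor \<open>- ln \<bar>z\<bar>\<close> is at least \<open>ln 2\<close>, so the kernel is at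
  least a constant times \<open>d\<close> to the power \<open>- (N + s p)\<close>. By Jensen's inequality the means of \<open>u\<close>
  over two balls of comparable radius \<open>r\<close> at distance at most \<open>r\<close> differ, in \<open>p\<close>-th power, by at
  most the double mean of \<open>\<bar>u a - u b\<bar>\<^sup>p\<close>, which is at most a constant times
  \<open>r\<close> to the power \<open>- 2 N + (N + s p) = s p - N\<close>, times \<open>E\<close>. Taking \<open>p\<close>-th roots, the
  means differ by at most \<open>K r\<^sup>\<beta>\<close> times the norm of \<open>u\<close> (\<open>ball_mean_oscillation\<close>).

  Since \<open>\<beta> > 0\<close>, the means over balls of dyadic radii form a Cauchy sequence with geometric rate,
  and comparing two centres at the scale of their distance shows that the limit \<open>v\<close> satisfies
  a \<open>\<beta>\<close>-Hoelder estimate at small distances (\<open>mean_oscillation_imp_Holder\<close>). That \<open>v = u\<close> almost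
  everywhere follows from the energy itself: by Tonelli's theorem the energy integral is finite
  on almost every fibre \<open>{x} \<times> \<real>\<^sup>N\<close>, and for such \<open>x\<close> the same estimates show that
  \<open>\<bar>u x - mean\<bar>\<close> is of order \<open>r\<^sup>s\<close> (\<open>ball_mean_tendsto_AE\<close>).

  The energy does not see large distances and contains no zero-order term, so the supremum of \<open>v\<close>
  has to come from the exterior condition. As \<open>u\<close> vanishes almost everywhere outside the bounded
  set \<open>\<Omega>\<close>, its ball means and therefore \<open>v\<close> vanish far away. Every point is joined to a zero of
  \<open>v\<close> by boundedly many steps of the length at which the local Hoelder estimate applies. This bounds
  \<open>\<bar>v\<bar>\<close> by a multiple of the norm of \<open>u\<close>, and with the bound the Hoelder estimate
  extends to all distances (\<open>locally_Holder_vanishing_far\<close>).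
\<close>

section \<open>Means over balls\<close>

text \<open>
  Jensen's inequality for the convex function \<open>t \<mapsto> \<bar>c - t\<bar>\<^sup>p\<close>. The supporting line at the mean is
  Young's inequality, which for \<open>m = \<bar>c - \<integral>f\<bar>\<close> reads
  \<open>p m\<^sup>p\<^sup>-\<^sup>1 \<bar>c - f\<bar> \<le> \<bar>c - f\<bar>\<^sup>p + (p - 1) m\<^sup>p\<close>; integrating it gives the claim.
\<close>
lemma powr_Jensen:
  assumes "prob_space M" and f: "integrable M f" and p: "1 < (p::real)"
  shows "ennreal (\<bar>c - (\<integral>x. f x \<partial>M)\<bar> powr p) \<le> (\<integral>\<^sup>+x. ennreal (\<bar>c - f x\<bar> powr p) \<partial>M)"
    (is "ennreal (?m powr p) \<le> ?I")
proof (cases "?I = \<infinity>")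
  case False
  interpret prob_space M by fact
  have [measurable]: "f \<in> borel_measurable M" using f by simp
  have intp: "integrable M (\<lambda>x. \<bar>c - f x\<bar> powr p)"
    using False by (intro integrableI_bounded) (auto simp: less_top)
  define q where "q = p / (p - 1)"
  have q: "1 < q" "1/p + 1/q = 1" "q > 0"
    using p by (auto simp: q_def field_simps)
  have Y: "p * ?m powr (p - 1) * \<bar>c - f x\<bar> \<le> \<bar>c - f x\<bar> powr p + (p - 1) * ?m powr p" for x
  proof -
    have "\<bar>c - f x\<bar> * ?m powr (p - 1) \<le> \<bar>c - f x\<bar> powr p / p + (?m powr (p - 1)) powr q / q"
      using Youngs_inequality[of p q "\<bar>c - f x\<bar>" "?m powr (p - 1)"] p q by simp
    moreover have "(?m powr (p - 1)) powr q = ?m powr p"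
      using p by (simp add: powr_powr q_def)
    moreover have "1 / q = (p - 1) / p" using p by (simp add: q_def)
    ultimately have "\<bar>c - f x\<bar> * ?m powr (p - 1) \<le> \<bar>c - f x\<bar> powr p / p + ?m powr p * ((p - 1) / p)"
      by (metis times_divide_eq_right mult.right_neutral)
    then have "p * (\<bar>c - f x\<bar> * ?m powr (p - 1)) \<le> p * (\<bar>c - f x\<bar> powr p / p + ?m powr p * ((p - 1) / p))"
      using p by (intro mult_left_mono) auto
    also have "\<dots> = \<bar>c - f x\<bar> powr p + (p - 1) * ?m powr p"
      using p by (simp add: distrib_left)
    finally show ?thesis by (simp add: mult_ac)
  qed
  have "c - (\<integral>x. f x \<partial>M) = (\<integral>x. c - f x \<partial>M)"
    using f by (simp add: prob_space)
  then have "?m \<le> (\<integral>x. \<bar>c - f x\<bar> \<partial>M)"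
    by (metis integral_abs_bound)
  then have "p * ?m powr (p - 1) * ?m \<le> p * ?m powr (p - 1) * (\<integral>x. \<bar>c - f x\<bar> \<partial>M)"
    using p by (intro mult_left_mono) auto
  also have "\<dots> = (\<integral>x. p * ?m powr (p - 1) * \<bar>c - f x\<bar> \<partial>M)"
    by simp
  also have "\<dots> \<le> (\<integral>x. \<bar>c - f x\<bar> powr p + (p - 1) * ?m powr p \<partial>M)"
    using f intp Y by (intro integral_mono) auto
  also have "\<dots> = (\<integral>x. \<bar>c - f x\<bar> powr p \<partial>M) + (p - 1) * ?m powr p"
    using intp by (simp add: prob_space)
  also have "p * ?m powr (p - 1) * ?m = p * ?m powr p"
    using powr_mult_base[of ?m "p - 1"] by (simp add: mult.commute mult.left_commute)
  finally have "?m powr p \<le> (\<integral>x. \<bar>c - f x\<bar> powr p \<partial>M)"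
    by (simp add: algebra_simps)
  then show ?thesis
    using intp by (subst nn_integral_eq_integral) auto
qed simp

definition ball_mean :: "('a::euclidean_space \<Rightarrow> real) \<Rightarrow> 'a \<Rightarrow> real \<Rightarrow> real" where
  "ball_mean u x r = (\<integral>y. u y \<partial>uniform_measure lborel (ball x r))"

lemma emeasure_ball_neq_0:
  fixes x :: "'a::euclidean_space"
  assumes "r > 0"
  shows "emeasure lborel (ball x r) \<noteq> 0"
proof -
  have "0 < unit_ball_vol (real DIM('a)) * r ^ DIM('a)" using assms by simp
  then show ?thesis using assms by (simp add: emeasure_ball ennreal_eq_0_iff not_le)
qed

lemma prob_space_uniform_ball:
  fixes x :: "'a::euclidean_space"
  assumes "r > 0"
  shows "prob_space (uniform_measure lborel (ball x r))"
  using emeasure_ball_neq_0[OF assms, of x] assms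
  by (intro prob_space_uniform_measure) (auto simp: emeasure_ball)

text \<open>Local integrability comes from \<open>\<bar>u\<bar> \<le> 1 + \<bar>u\<bar>\<^sup>p\<close>.\<close>
lemma integrable_uniform_ball:
  fixes u :: "'a::euclidean_space \<Rightarrow> real"
  assumes [measurable]: "u \<in> borel_measurable borel"
    and up: "(\<integral>\<^sup>+x. ennreal (\<bar>u x\<bar> powr p) \<partial>lborel) < \<infinity>" and "1 < p" and r: "r > 0"
  shows "integrable (uniform_measure lborel (ball x r)) u"
proof -
  interpret prob_space "uniform_measure lborel (ball x r)"
    by (rule prob_space_uniform_ball[OF r])
  have "t \<le> 1 + t powr p" if "t \<ge> 0" for t :: real
  proof (cases "t \<le> 1")
    case False
    then have "t powr 1 \<le> t powr p" using \<open>1 < p\<close> by (intro powr_mono) auto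
    then show ?thesis using False by simp
  qed (use powr_ge_zero[of t p] in linarith)
  then have "ennreal \<bar>u y\<bar> \<le> 1 + ennreal (\<bar>u y\<bar> powr p)" for y
    by (metis abs_ge_zero ennreal_1 ennreal_leI ennreal_plus powr_ge_zero zero_le_one)
  then have "(\<integral>\<^sup>+y. ennreal \<bar>u y\<bar> \<partial>uniform_measure lborel (ball x r))
      \<le> (\<integral>\<^sup>+y. 1 + ennreal (\<bar>u y\<bar> powr p) \<partial>uniform_measure lborel (ball x r))"
    by (intro nn_integral_mono)
  also have "\<dots> = 1 + (\<integral>\<^sup>+y. ennreal (\<bar>u y\<bar> powr p) \<partial>uniform_measure lborel (ball x r))"
    by (subst nn_integral_add) (auto simp: emeasure_space_1[simplified])
  also have "\<dots> = 1 + (\<integral>\<^sup>+y. ennreal (\<bar>u y\<bar> powr p) * indicator (ball x r) y \<partial>lborel) / emeasure lborel (ball x r)"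
    by (subst nn_integral_uniform_measure) auto
  also have "\<dots> \<le> 1 + (\<integral>\<^sup>+y. ennreal (\<bar>u y\<bar> powr p) \<partial>lborel) / emeasure lborel (ball x r)"
    by (intro add_left_mono divide_right_mono_ennreal nn_integral_mono) (auto simp: indicator_def)
  also have "\<dots> < \<infinity>"
    using up emeasure_ball_neq_0[OF r, of x] by (auto simp: ennreal_divide_eq_top_iff less_top[symmetric])
  finally show ?thesis
    by (intro integrableI_bounded) auto
qed

lemma ball_mean_powr_le:
  fixes u :: "'a::euclidean_space \<Rightarrow> real"
  assumes "u \<in> borel_measurable borel"
    and "(\<integral>\<^sup>+x. ennreal (\<bar>u x\<bar> powr p) \<partial>lborel) < \<infinity>" and "1 < p" and "r > 0"
  shows "ennreal (\<bar>c - ball_mean u x r\<bar> powr p)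
    \<le> (\<integral>\<^sup>+y. ennreal (\<bar>c - u y\<bar> powr p) * indicator (ball x r) y \<partial>lborel) / emeasure lborel (ball x r)"
proof -
  note [measurable] = assms(1)
  have "ennreal (\<bar>c - ball_mean u x r\<bar> powr p)
    \<le> (\<integral>\<^sup>+y. ennreal (\<bar>c - u y\<bar> powr p) \<partial>uniform_measure lborel (ball x r))"
    unfolding ball_mean_def
    by (intro powr_Jensen prob_space_uniform_ball integrable_uniform_ball[OF assms(1,2)] assms)
  then show ?thesis by (subst (asm) nn_integral_uniform_measure) auto
qed

text \<open>
  Jensen's inequality twice: with the second mean as the constant \<open>c\<close> and \<open>u\<close> averaged over the
  first ball, then with \<open>c = u a\<close> and \<open>u\<close> averaged over the second ball.
\<close>
lemma ball_mean_diff_powr_le: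
  fixes u :: "'a::euclidean_space \<Rightarrow> real"
  assumes "u \<in> borel_measurable borel"
    and "(\<integral>\<^sup>+x. ennreal (\<bar>u x\<bar> powr p) \<partial>lborel) < \<infinity>" and "1 < p" and "r > 0" "\<rho> > 0"
  shows "ennreal (\<bar>ball_mean u x r - ball_mean u y \<rho>\<bar> powr p)
    \<le> (\<integral>\<^sup>+a. (\<integral>\<^sup>+b. ennreal (\<bar>u a - u b\<bar> powr p) * indicator (ball y \<rho>) b \<partial>lborel)
          * indicator (ball x r) a \<partial>lborel)
        / (emeasure lborel (ball x r) * emeasure lborel (ball y \<rho>))"
proof -
  note [measurable] = assms(1)
  let ?m = "ball_mean u y \<rho>"
  have [measurable]: "(\<lambda>a. \<integral>\<^sup>+b. ennreal (\<bar>u a - u b\<bar> powr p) * indicator (ball y \<rho>) b \<partial>lborel) \<in> borel_measurable lborel"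
    unfolding indicator_def mem_ball by measurable
  have meas: "(\<lambda>a. (\<integral>\<^sup>+b. ennreal (\<bar>u a - u b\<bar> powr p) * indicator (ball y \<rho>) b \<partial>lborel)
          * indicator (ball x r) a) \<in> borel_measurable lborel"
    unfolding indicator_def mem_ball by measurable
  have "ennreal (\<bar>ball_mean u x r - ?m\<bar> powr p)
    \<le> (\<integral>\<^sup>+a. ennreal (\<bar>?m - u a\<bar> powr p) * indicator (ball x r) a \<partial>lborel) / emeasure lborel (ball x r)"
    using ball_mean_powr_le[OF assms(1-4), of ?m x] by (simp add: abs_minus_commute)
  also have "\<dots> \<le> (\<integral>\<^sup>+a. (\<integral>\<^sup>+b. ennreal (\<bar>u a - u b\<bar> powr p) * indicator (ball y \<rho>) b \<partial>lborel)
         / emeasure lborel (ball y \<rho>) * indicator (ball x r) a \<partial>lborel) / emeasure lborel (ball x r)"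
    using ball_mean_powr_le[OF assms(1-3,5), of _ y]
    by (intro divide_right_mono_ennreal nn_integral_mono mult_right_mono) (auto simp: abs_minus_commute)
  also have "\<dots> = (\<integral>\<^sup>+a. (\<integral>\<^sup>+b. ennreal (\<bar>u a - u b\<bar> powr p) * indicator (ball y \<rho>) b \<partial>lborel)
          * indicator (ball x r) a / emeasure lborel (ball y \<rho>) \<partial>lborel) / emeasure lborel (ball x r)"
    by (simp add: divide_ennreal_def mult_ac)
  also have "\<dots> = (\<integral>\<^sup>+a. (\<integral>\<^sup>+b. ennreal (\<bar>u a - u b\<bar> powr p) * indicator (ball y \<rho>) b \<partial>lborel)
          * indicator (ball x r) a \<partial>lborel) / emeasure lborel (ball y \<rho>) / emeasure lborel (ball x r)"
    by (simp only: nn_integral_divide[OF meas])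
  also have "\<dots> = (\<integral>\<^sup>+a. (\<integral>\<^sup>+b. ennreal (\<bar>u a - u b\<bar> powr p) * indicator (ball y \<rho>) b \<partial>lborel)
          * indicator (ball x r) a \<partial>lborel) / (emeasure lborel (ball x r) * emeasure lborel (ball y \<rho>))"
    using assms by (simp add: divide_ennreal_def emeasure_ball ennreal_inverse_mult mult_ac)
  finally show ?thesis .
qed

section \<open>The energy near the diagonal\<close>

lemma kernel_const_pos:
  assumes "0 < s" "s < 1" "1 < p"
  shows "0 < kernel_const N s p"
  using assms unfolding kernel_const_def
  by (auto intro!: divide_pos_pos mult_pos_pos Gamma_real_pos add_nonneg_pos)

lemma borel_measurable_log_kernel [measurable]:
  "(log_kernel s p :: 'a::euclidean_space \<Rightarrow> real) \<in> borel_measurable borel"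
  unfolding log_kernel_def[abs_def] by measurable

text \<open>
  Any threshold for \<open>d\<close> below \<open>1\<close> would keep the logarithm away from zero; \<open>1/2\<close> makes it at
  least \<open>ln 2\<close>. On the diagonal, where the kernel has a default value, both sides vanish.
\<close>
lemma diff_powr_le_energy_density:
  fixes a b :: "'a::euclidean_space"
  assumes "0 < s" "s < 1" "1 < p" and d: "norm (a - b) \<le> d" "d \<le> 1/2"
  shows "\<bar>u a - u b\<bar> powr p \<le> d powr (real DIM('a) + s * p) / (kernel_const DIM('a) s p * ln 2)
           * (\<bar>u a - u b\<bar> powr p * log_kernel s p (a - b))"
proof (cases "a = b")
  case False
  define z where "z = a - b"
  define c where "c = kernel_const DIM('a) s p"
  define M where "M = real DIM('a) + s * p"
  have c: "c > 0" using kernel_const_pos assms by (simp add: c_def)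
  have z: "0 < norm z" "norm z \<le> d" using False d by (auto simp: z_def)
  have "ln 2 = - ln (1/2::real)" by (simp add: ln_div)
  also have "\<dots> \<le> - ln (norm z)" using z d by simp
  finally have "ln 2 \<le> max 0 (- ln (norm z))" by simp
  moreover have "norm z powr M \<le> d powr M" using z assms by (intro powr_mono2) (auto simp: M_def)
  ultimately have "c * ln 2 / d powr M \<le> c * max 0 (- ln (norm z)) / norm z powr M"
    using c z by (intro frac_le mult_left_mono mult_nonneg_nonneg) auto
  then have "d powr M / (c * ln 2) * (c * ln 2 / d powr M) \<le> d powr M / (c * ln 2) * log_kernel s p z"
    using c by (intro mult_left_mono) (auto simp: log_kernel_def c_def M_def)
  then have "1 \<le> d powr M / (c * ln 2) * log_kernel s p z"
    using c z by (simp add: field_simps)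
  from mult_left_mono[OF this, of "\<bar>u a - u b\<bar> powr p"]
  show ?thesis by (simp add: z_def c_def M_def mult_ac)
qed simp

text \<open>
  The fibre of the energy over \<open>a\<close> controls the local \<open>p\<close>-oscillation of \<open>u\<close> around the value \<open>u a\<close>.
  Applied to a single \<open>a\<close> it yields pointwise convergence of ball means; integrated over \<open>a\<close> in
  a second ball it compares two means.
\<close>
lemma oscillation_le_energy_fibre:
  fixes u :: "'a::euclidean_space \<Rightarrow> real"
  assumes "0 < s" "s < 1" "1 < p"
    and u [measurable]: "u \<in> borel_measurable borel"
    and S: "\<And>b. b \<in> S \<Longrightarrow> norm (a - b) \<le> d" and d: "d \<le> 1/2"
  shows "(\<integral>\<^sup>+b. ennreal (\<bar>u a - u b\<bar> powr p) * indicator S b \<partial>lborel)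
    \<le> ennreal (d powr (real DIM('a) + s * p) / (kernel_const DIM('a) s p * ln 2))
        * (\<integral>\<^sup>+b. ennreal (\<bar>u a - u b\<bar> powr p * log_kernel s p (a - b)) \<partial>lborel)"
    (is "?L \<le> ennreal ?T * _")
proof -
  have T: "?T \<ge> 0" using kernel_const_pos[OF assms(1-3)] by (simp add: less_imp_le)
  have "?L \<le> (\<integral>\<^sup>+b. ennreal ?T * ennreal (\<bar>u a - u b\<bar> powr p * log_kernel s p (a - b)) \<partial>lborel)"
  proof (rule nn_integral_mono)
    fix b
    show "ennreal (\<bar>u a - u b\<bar> powr p) * indicator S b
      \<le> ennreal ?T * ennreal (\<bar>u a - u b\<bar> powr p * log_kernel s p (a - b))"
    proof (cases "b \<in> S")
      case True
      from diff_powr_le_energy_density[OF assms(1-3) S[OF True] d, of u]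
      show ?thesis using True by (simp add: T ennreal_leI flip: ennreal_mult')
    qed simp
  qed
  also have "\<dots> = ennreal ?T * (\<integral>\<^sup>+b. ennreal (\<bar>u a - u b\<bar> powr p * log_kernel s p (a - b)) \<partial>lborel)"
    by (rule nn_integral_cmult) measurable
  finally show ?thesis .
qed

lemma W_energy_iterated:
  fixes u :: "'a::euclidean_space \<Rightarrow> real"
  assumes [measurable]: "u \<in> borel_measurable borel"
  shows "W_energy s p u
    = (\<integral>\<^sup>+x. \<integral>\<^sup>+y. ennreal (\<bar>u x - u y\<bar> powr p * log_kernel s p (x - y)) \<partial>lborel \<partial>lborel)"
proof -
  have "W_energy s p u = (\<integral>\<^sup>+z. ennreal (\<bar>u (fst z) - u (snd z)\<bar> powr p * log_kernel s p (fst z - snd z))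
      \<partial>(lborel \<Otimes>\<^sub>M lborel))"
    by (simp add: W_energy_def nn_integral_completion lborel_prod split_def)
  also have "\<dots> = (\<integral>\<^sup>+x. \<integral>\<^sup>+y. ennreal (\<bar>u x - u y\<bar> powr p * log_kernel s p (x - y)) \<partial>lborel \<partial>lborel)"
    by (subst lborel.nn_integral_fst[symmetric]) auto
  finally show ?thesis .
qed

lemma W_energy_eq_W_norm:
  assumes "W_energy s p u < \<infinity>" "p > 0"
  shows "W_energy s p u = ennreal (W_norm s p u powr p)"
proof -
  have "W_norm s p u powr p = enn2real (W_energy s p u)"
    using assms by (simp add: W_norm_def powr_powr)
  then show ?thesis using assms by simp
qed

text \<open>
  If \<open>u = w\<close> off the null set \<open>Z\<close>, the two integrands agree off \<open>Z \<times> \<real>\<^sup>N \<union> \<real>\<^sup>N \<times> Z\<close>. This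
  allows \<open>u\<close> to be replaced by a Borel function, to which Tonelli's theorem applies.
\<close>
lemma W_energy_cong_AE:
  fixes u w :: "'a::euclidean_space \<Rightarrow> real"
  assumes "AE x in lborel. u x = w x"
  shows "W_energy s p u = W_energy s p w"
proof -
  from assms obtain Z where Z: "{x. u x \<noteq> w x} \<subseteq> Z" "Z \<in> null_sets lborel"
    by (auto elim!: AE_E simp: null_sets_def)
  have "Z \<times> UNIV \<in> null_sets (lborel \<Otimes>\<^sub>M lborel :: ('a \<times> 'a) measure)"
    "UNIV \<times> Z \<in> null_sets (lborel \<Otimes>\<^sub>M lborel :: ('a \<times> 'a) measure)"
    using Z(2) by (auto simp: null_sets_def lborel.emeasure_pair_measure_Times)
  then have "Z \<times> UNIV \<union> UNIV \<times> Z \<in> null_sets (lborel :: ('a \<times> 'a) measure)"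
    unfolding lborel_prod by auto
  then have "AE z in lborel. z \<notin> Z \<times> UNIV \<union> UNIV \<times> Z"
    by (rule AE_not_in)
  then have "AE z in lebesgue. z \<notin> Z \<times> UNIV \<union> UNIV \<times> Z"
    by (rule AE_completion)
  then have "AE z in lebesgue. u (fst z) = w (fst z) \<and> u (snd z) = w (snd z)"
    by (rule eventually_mono) (use Z(1) in auto)
  then show ?thesis
    unfolding W_energy_def split_def by (intro nn_integral_cong_AE) (rule eventually_mono, auto)
qed

lemma le_if_powr_le_powr:
  fixes a b p :: real
  assumes "a powr p \<le> b powr p" "0 < p" "0 \<le> b"
  shows "a \<le> b"
  using assms powr_less_mono2[of p b a] by linarith

section \<open>Oscillation and convergence of ball means\<close>

text \<open>
  For \<open>a\<close> and \<open>b\<close> in the two balls, \<open>\<bar>a - b\<bar> \<le> 3 r \<le> 1/2\<close>; this is where the bound \<open>r \<le> 1/6\<close>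
  comes from. The constant depends only on the dimension, \<open>s\<close> and \<open>p\<close>, hence the quantification
  over \<open>u\<close> inside the existential.
\<close>
lemma ball_mean_oscillation:
  assumes "0 < s" "s < 1" "1 < p"
  shows "\<exists>K\<ge>0. \<forall>(u :: 'a::euclidean_space \<Rightarrow> real) x y r \<rho>.
     u \<in> borel_measurable borel \<longrightarrow> (\<integral>\<^sup>+x. ennreal (\<bar>u x\<bar> powr p) \<partial>lborel) < \<infinity> \<longrightarrow>
     W_energy s p u < \<infinity> \<longrightarrow>
     0 < \<rho> \<longrightarrow> \<rho> \<le> r \<longrightarrow> r \<le> 2 * \<rho> \<longrightarrow> r \<le> 1/6 \<longrightarrow> dist x y \<le> r \<longrightarrow>
     \<bar>ball_mean u x r - ball_mean u y \<rho>\<bar> \<le> K * W_norm s p u * r powr (s - real DIM('a) / p)"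
proof -
  define N where "N = DIM('a)"
  define \<omega> where "\<omega> = unit_ball_vol (real N)"
  define A where "A = 1 / (kernel_const N s p * ln 2)"
  define B where "B = A * 3 powr (N + s * p) * 2 ^ N / \<omega>\<^sup>2"
  have pos: "\<omega> > 0" "A > 0" using kernel_const_pos assms by (auto simp: \<omega>_def A_def)
  then have "B > 0" by (simp add: B_def)
  have "\<bar>ball_mean u x r - ball_mean u y \<rho>\<bar> \<le> B powr (1/p) * W_norm s p u * r powr (s - N / p)"
    if u [measurable]: "u \<in> borel_measurable borel"
      and up: "(\<integral>\<^sup>+x. ennreal (\<bar>u x\<bar> powr p) \<partial>lborel) < \<infinity>" and Ef: "W_energy s p u < \<infinity>"
      and r: "0 < \<rho>" "\<rho> \<le> r" "r \<le> 2 * \<rho>" "r \<le> 1/6" "dist x y \<le> r"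
    for u :: "'a \<Rightarrow> real" and x y r \<rho>
  proof -
    define e where "e = W_norm s p u"
    have e: "e \<ge> 0" "W_energy s p u = ennreal (e powr p)"
      using W_energy_eq_W_norm[OF Ef] assms by (auto simp: e_def W_norm_def)
    define T where "T = (3 * r) powr (N + s * p) * A"
    have "r > 0" using r by simp
    have "(\<integral>\<^sup>+a. (\<integral>\<^sup>+b. ennreal (\<bar>u a - u b\<bar> powr p) * indicator (ball y \<rho>) b \<partial>lborel)
          * indicator (ball x r) a \<partial>lborel)
       \<le> (\<integral>\<^sup>+a. ennreal T * (\<integral>\<^sup>+b. ennreal (\<bar>u a - u b\<bar> powr p * log_kernel s p (a - b)) \<partial>lborel) \<partial>lborel)"
    proof (rule nn_integral_mono)
      fix a :: 'a
      show "(\<integral>\<^sup>+b. ennreal (\<bar>u a - u b\<bar> powr p) * indicator (ball y \<rho>) b \<partial>lborel) * indicator (ball x r) a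
        \<le> ennreal T * (\<integral>\<^sup>+b. ennreal (\<bar>u a - u b\<bar> powr p * log_kernel s p (a - b)) \<partial>lborel)"
      proof (cases "a \<in> ball x r")
        case True
        have "norm (a - b) \<le> 3 * r" if "b \<in> ball y \<rho>" for b
          using True that r dist_triangle[of a b y] dist_triangle[of a y x]
          by (simp add: dist_commute flip: dist_norm)
        then show ?thesis
          using oscillation_le_energy_fibre[OF assms u, of "ball y \<rho>" a "3 * r"] True r
          by (simp add: T_def A_def N_def)
      qed simp
    qed
    also have "\<dots> = ennreal T * W_energy s p u"
    proof -
      have [measurable]: "(\<lambda>a. \<integral>\<^sup>+b. ennreal (\<bar>u a - u b\<bar> powr p * log_kernel s p (a - b)) \<partial>lborel)
          \<in> borel_measurable lborel" by measurable
      show ?thesis unfolding W_energy_iterated[OF u]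
        by (simp add: nn_integral_cmult)
    qed
    finally have "ennreal (\<bar>ball_mean u x r - ball_mean u y \<rho>\<bar> powr p)
        \<le> ennreal T * ennreal (e powr p) / (emeasure lborel (ball x r) * emeasure lborel (ball y \<rho>))"
      using ball_mean_diff_powr_le[OF u up \<open>1 < p\<close> \<open>r > 0\<close> \<open>\<rho> > 0\<close>, of x y]
      by (auto simp: e intro: order_trans divide_right_mono_ennreal)
    also have "\<dots> = ennreal (T * e powr p / ((\<omega> * r ^ N) * (\<omega> * \<rho> ^ N)))"
      using pos \<open>r > 0\<close> \<open>\<rho> > 0\<close>
      by (simp add: emeasure_ball \<omega>_def N_def T_def divide_ennreal flip: ennreal_mult')
    finally have "\<bar>ball_mean u x r - ball_mean u y \<rho>\<bar> powr p \<le> T * e powr p / ((\<omega> * r ^ N) * (\<omega> * \<rho> ^ N))"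
      using pos \<open>r > 0\<close> \<open>\<rho> > 0\<close> by (subst (asm) ennreal_le_iff) (auto simp: T_def)
    \<comment> \<open>Comparability of the radii, \<open>r \<le> 2 \<rho>\<close>, enters here.\<close>
    also have "\<dots> \<le> T * e powr p / ((\<omega> * r ^ N) * (\<omega> * (r / 2) ^ N))"
      using pos r \<open>r > 0\<close> by (intro divide_left_mono mult_left_mono power_mono mult_pos_pos) (auto simp: T_def)
    also have "\<dots> = B * (e powr p) * r powr (s * p - N)"
      using \<open>r > 0\<close> pos
      by (simp add: T_def B_def powr_mult powr_add powr_diff powr_realpow power_divide power2_eq_square field_simps)
    also have "\<dots> = (B powr (1/p) * e * r powr (s - N / p)) powr p"
      using \<open>B > 0\<close> e assms by (simp add: powr_mult powr_powr left_diff_distrib)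
    finally have "\<bar>ball_mean u x r - ball_mean u y \<rho>\<bar> powr p \<le> (B powr (1/p) * e * r powr (s - N / p)) powr p" .
    then show ?thesis
      unfolding e_def[symmetric] using \<open>1 < p\<close> e by (elim le_if_powr_le_powr) auto
  qed
  then show ?thesis unfolding N_def by (intro exI[of _ "B powr (1/p)"]) auto
qed

text \<open>
  At a point \<open>x\<close> over which the fibre of the energy is finite, with value \<open>F\<close>, the mean of
  \<open>\<bar>u x - u y\<bar>\<^sup>p\<close> over the ball of radius \<open>r\<close> is at most a constant times
  \<open>r\<close> to the power \<open>- N + (N + s p) = s p\<close>, times \<open>F\<close>. By Tonelli's theorem almost every point
  is of this kind.
\<close>
lemma ball_mean_tendsto_AE:
  fixes u :: "'a::euclidean_space \<Rightarrow> real"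
  assumes "0 < s" "s < 1" "1 < p"
    and u [measurable]: "u \<in> borel_measurable borel"
    and up: "(\<integral>\<^sup>+x. ennreal (\<bar>u x\<bar> powr p) \<partial>lborel) < \<infinity>" and Ef: "W_energy s p u < \<infinity>"
  shows "AE x in lborel. (ball_mean u x \<longlongrightarrow> u x) (at_right 0)"
proof -
  let ?F = "\<lambda>x. \<integral>\<^sup>+y. ennreal (\<bar>u x - u y\<bar> powr p * log_kernel s p (x - y)) \<partial>lborel"
  have "?F \<in> borel_measurable lborel" by measurable
  then have "AE x in lborel. ?F x \<noteq> \<infinity>"
    using Ef unfolding W_energy_iterated[OF u] by (intro nn_integral_PInf_AE) auto
  then show ?thesis
  proof (rule eventually_mono)
    fix x :: 'a
    assume "?F x \<noteq> \<infinity>"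
    then obtain F where F: "F \<ge> 0" "?F x = ennreal F"
      by (cases "?F x") auto
    define N where "N = DIM('a)"
    define \<omega> where "\<omega> = unit_ball_vol (real N)"
    define A where "A = 1 / (kernel_const N s p * ln 2)"
    have pos: "\<omega> > 0" "A > 0" using kernel_const_pos assms by (auto simp: \<omega>_def A_def)
    have "\<bar>u x - ball_mean u x r\<bar> \<le> (A * F / \<omega>) powr (1/p) * r powr s" if r: "0 < r" "r < 1/2" for r
    proof -
      define T where "T = r powr (N + s * p) * A"
      have "(\<integral>\<^sup>+y. ennreal (\<bar>u x - u y\<bar> powr p) * indicator (ball x r) y \<partial>lborel) \<le> ennreal T * ennreal F"
        using oscillation_le_energy_fibre[OF assms(1-3) u, of "ball x r" x r] r
        by (simp add: T_def A_def N_def F dist_norm)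
      then have "ennreal (\<bar>u x - ball_mean u x r\<bar> powr p) \<le> ennreal T * ennreal F / emeasure lborel (ball x r)"
        using ball_mean_powr_le[OF u up \<open>1 < p\<close> \<open>0 < r\<close>, of "u x" x]
        by (auto intro: order_trans divide_right_mono_ennreal)
      also have "\<dots> = ennreal (T * F / (\<omega> * r ^ N))"
        using pos r F by (simp add: emeasure_ball \<omega>_def N_def T_def divide_ennreal flip: ennreal_mult')
      finally have "\<bar>u x - ball_mean u x r\<bar> powr p \<le> T * F / (\<omega> * r ^ N)"
        using pos r F by (subst (asm) ennreal_le_iff) (auto simp: T_def)
      also have "\<dots> = A * F / \<omega> * r powr (s * p)"
        using r pos by (simp add: T_def powr_add powr_realpow)
      also have "\<dots> = ((A * F / \<omega>) powr (1/p) * r powr s) powr p"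
        using F pos assms by (simp add: powr_mult powr_powr)
      finally have "\<bar>u x - ball_mean u x r\<bar> powr p \<le> ((A * F / \<omega>) powr (1/p) * r powr s) powr p" .
      then show ?thesis
        using \<open>1 < p\<close> by (elim le_if_powr_le_powr) auto
    qed
    then have ev: "\<forall>\<^sub>F r in at_right 0. norm (ball_mean u x r - u x) \<le> (A * F / \<omega>) powr (1/p) * r powr s"
      by (auto simp: eventually_at_right_field abs_minus_commute intro!: exI[of _ "1/2"])
    have "((\<lambda>r. (A * F / \<omega>) powr (1/p) * r powr s) \<longlongrightarrow> (A * F / \<omega>) powr (1/p) * 0 powr s) (at_right 0)"
      using \<open>0 < s\<close>
      by (intro tendsto_mult tendsto_const tendsto_powr' tendsto_ident_at)
         (auto simp: eventually_at_right_field intro!: exI[of _ 1])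
    then have "((\<lambda>r. ball_mean u x r - u x) \<longlongrightarrow> 0) (at_right 0)"
      using ev by (intro Lim_null_comparison[OF ev]) simp
    then show "(ball_mean u x \<longlongrightarrow> u x) (at_right 0)"
      by (simp add: LIM_zero_iff)
  qed
qed

section \<open>From oscillation of means to Hoelder continuity\<close>

lemma geometric_steps_limit:
  fixes a :: "nat \<Rightarrow> real"
  assumes step: "\<And>k. \<bar>a k - a (Suc k)\<bar> \<le> D * q ^ k" and q: "0 < q" "q < 1"
  shows "\<exists>l. a \<longlonglongrightarrow> l \<and> (\<forall>k. \<bar>a k - l\<bar> \<le> D * q ^ k / (1 - q))"
proof -
  have sm: "summable (\<lambda>k. D * q ^ k)" using q by (intro summable_mult summable_geometric) auto
  have sd: "summable (\<lambda>k. norm (a (Suc k) - a k))"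
    using step by (intro summable_comparison_test'[OF sm, of 0]) (auto simp: abs_minus_commute)
  then have sd': "summable (\<lambda>k. a (Suc k) - a k)" by (rule summable_norm_cancel)
  then have "convergent (\<lambda>n. \<Sum>k<n. a (Suc k) - a k)"
    by (simp add: summable_iff_convergent)
  then have "convergent (\<lambda>n. a n - a 0)" by (simp add: sum_lessThan_telescope)
  then obtain l0 where "(\<lambda>n. a n - a 0) \<longlonglongrightarrow> l0" by (auto simp: convergent_def)
  from tendsto_add[OF this tendsto_const[of "a 0"]] have l: "a \<longlonglongrightarrow> l0 + a 0" by simp
  have "\<bar>a k - (l0 + a 0)\<bar> \<le> D * q ^ k / (1 - q)" for k
  proof -
    have "\<bar>a k - a (k + n)\<bar> \<le> D * q ^ k * ((1 - q ^ n) / (1 - q))" for n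
    proof (induction n)
      case (Suc n)
      have "(1 - q ^ Suc n) / (1 - q) = (1 - q ^ n) / (1 - q) + q ^ n"
        using q by (simp add: field_simps)
      moreover have "\<bar>a k - a (k + Suc n)\<bar> \<le> \<bar>a k - a (k + n)\<bar> + D * q ^ k * q ^ n"
        using step[of "k + n"] by (simp add: power_add mult.assoc)
      ultimately show ?case using Suc by (simp add: distrib_left)
    qed simp
    moreover have "D * q ^ k * ((1 - q ^ n) / (1 - q)) \<le> D * q ^ k / (1 - q)" for n
    proof -
      have "0 \<le> D * q ^ k" using step[of k] by linarith
      then have "D * q ^ k * ((1 - q ^ n) / (1 - q)) \<le> D * q ^ k * (1 / (1 - q))"
        using q by (intro mult_left_mono divide_right_mono) auto
      then show ?thesis by simp
    qed
    ultimately have "\<bar>a k - a (k + n)\<bar> \<le> D * q ^ k / (1 - q)" for n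
      by (meson order_trans)
    moreover have "(\<lambda>n. \<bar>a k - a (k + n)\<bar>) \<longlonglongrightarrow> \<bar>a k - (l0 + a 0)\<bar>"
      using LIMSEQ_ignore_initial_segment[OF l, of k] by (intro tendsto_intros) (simp add: add.commute)
    ultimately show ?thesis by (meson LIMSEQ_le_const2)
  qed
  with l show ?thesis by blast
qed

lemma dyadic_scale:
  fixes d r :: real
  assumes "0 < d" "d \<le> r"
  shows "\<exists>k::nat. d \<le> r / 2 ^ k \<and> r / 2 ^ k \<le> 2 * d"
proof -
  have "\<exists>k::nat. r / 2 ^ k < d"
  proof -
    obtain k :: nat where "r / d < 2 ^ k" using real_arch_pow[of 2 "r / d"] by auto
    then show ?thesis using assms by (intro exI[of _ k]) (simp add: field_simps)
  qed
  then obtain k where k: "r / 2 ^ k < d" "\<forall>j<k. \<not> r / 2 ^ j < d"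
    using exists_least_iff[of "\<lambda>k. r / 2 ^ k < d"] by auto
  then have "k \<noteq> 0" using assms by (intro notI) auto
  then obtain j where j: "k = Suc j" by (cases k) auto
  then show ?thesis using k by (intro exI[of _ j]) (auto simp: not_less)
qed

text \<open>
  Abstracted from ball means, \<open>m\<close> is any function of centre and radius with their oscillation bound.
  Along dyadic radii the bound is geometric with ratio \<open>2\<close> to the power \<open>- \<beta>\<close>, so \<open>m x\<close> at scale
  \<open>r\<close> is within \<open>D r\<^sup>\<beta> / (1 - 2 powr - \<beta>)\<close> of its limit. For \<open>x \<noteq> y\<close> the values of \<open>v\<close> are compared
  through the means at a dyadic radius between \<open>dist x y\<close> and \<open>2 * dist x y\<close>: two limit errors and
  one change of centre give the factor \<open>1 + 2 / (1 - 2 powr - \<beta>)\<close>, and replacing the radius by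
  \<open>2 * dist x y\<close> gives \<open>2 powr \<beta>\<close>.
\<close>
lemma mean_oscillation_imp_Holder:
  fixes m :: "'a::metric_space \<Rightarrow> real \<Rightarrow> real"
  assumes osc: "\<And>x y r \<rho>. \<lbrakk>0 < \<rho>; \<rho> \<le> r; r \<le> 2 * \<rho>; r \<le> r0; dist x y \<le> r\<rbrakk>
      \<Longrightarrow> \<bar>m x r - m y \<rho>\<bar> \<le> D * r powr \<beta>"
    and "r0 > 0" "\<beta> > 0" "D \<ge> 0"
  shows "\<exists>v. (\<forall>x. (\<lambda>k. m x (r0 / 2 ^ k)) \<longlonglongrightarrow> v x) \<and>
     (\<forall>x y. dist x y \<le> r0 \<longrightarrow>
        \<bar>v x - v y\<bar> \<le> (1 + 2 / (1 - 2 powr - \<beta>)) * 2 powr \<beta> * D * dist x y powr \<beta>)"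
proof -
  define q where "q = 2 powr - \<beta>"
  have q: "0 < q" "q < 1" using \<open>\<beta> > 0\<close> by (auto simp: q_def powr_less_one)
  have rk: "(r0 / 2 ^ k) powr \<beta> = r0 powr \<beta> * q ^ k" for k :: nat
  proof -
    have "q ^ k = 2 powr (- \<beta> * k)" by (simp add: q_def powr_powr flip: powr_realpow)
    also have "\<dots> = 1 / (2 ^ k) powr \<beta>"
      by (simp add: powr_powr powr_minus_divide mult.commute flip: powr_realpow)
    finally show ?thesis using \<open>r0 > 0\<close> by (simp add: powr_divide)
  qed
  have "\<exists>l. (\<lambda>k. m x (r0 / 2 ^ k)) \<longlonglongrightarrow> l \<and>
      (\<forall>k. \<bar>m x (r0 / 2 ^ k) - l\<bar> \<le> D * r0 powr \<beta> * q ^ k / (1 - q))" for x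
  proof (rule geometric_steps_limit[OF _ q])
    fix k
    have "r0 / 2 ^ k \<le> r0" using \<open>r0 > 0\<close> by (simp add: field_simps)
    then have "\<bar>m x (r0 / 2 ^ k) - m x (r0 / 2 ^ Suc k)\<bar> \<le> D * (r0 / 2 ^ k) powr \<beta>"
      using \<open>r0 > 0\<close> by (intro osc) (auto simp: field_simps)
    then show "\<bar>m x (r0 / 2 ^ k) - m x (r0 / 2 ^ Suc k)\<bar> \<le> D * r0 powr \<beta> * q ^ k"
      by (simp add: rk mult.assoc)
  qed
  then obtain v where v: "\<And>x. (\<lambda>k. m x (r0 / 2 ^ k)) \<longlonglongrightarrow> v x"
    and err: "\<And>x k. \<bar>m x (r0 / 2 ^ k) - v x\<bar> \<le> D * (r0 / 2 ^ k) powr \<beta> / (1 - q)"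
    unfolding rk by (metis mult.assoc)
  have "\<bar>v x - v y\<bar> \<le> (1 + 2 / (1 - q)) * 2 powr \<beta> * D * dist x y powr \<beta>"
    if "dist x y \<le> r0" for x y
  proof (cases "x = y")
    case False
    then obtain k :: nat where k: "dist x y \<le> r0 / 2 ^ k" "r0 / 2 ^ k \<le> 2 * dist x y"
      using dyadic_scale[of "dist x y" r0] \<open>dist x y \<le> r0\<close> by auto
    let ?r = "r0 / 2 ^ k"
    have "?r \<le> r0" using \<open>r0 > 0\<close> by (simp add: field_simps)
    then have "\<bar>m x ?r - m y ?r\<bar> \<le> D * ?r powr \<beta>"
      using k \<open>r0 > 0\<close> by (intro osc) auto
    then have "\<bar>v x - v y\<bar> \<le> D * ?r powr \<beta> + 2 * (D * ?r powr \<beta> / (1 - q))"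
      using err[of x k] err[of y k] by linarith
    also have "\<dots> = (1 + 2 / (1 - q)) * D * ?r powr \<beta>"
      by (simp add: algebra_simps)
    also have "\<dots> \<le> (1 + 2 / (1 - q)) * D * (2 * dist x y) powr \<beta>"
      using k q \<open>D \<ge> 0\<close> \<open>r0 > 0\<close> \<open>\<beta> > 0\<close> by (intro mult_left_mono powr_mono2) auto
    finally show ?thesis by (simp add: powr_mult mult_ac)
  qed simp
  with v show ?thesis unfolding q_def by blast
qed

text \<open>
  Walking from \<open>x\<close> in a fixed coordinate direction, \<open>n\<close> steps of length \<open>r0\<close> lead to a point of
  norm at least \<open>n r0 - R \<ge> R\<close>, where \<open>v\<close> is zero.
\<close>
lemma vanishing_far_imp_bounded:
  fixes v :: "'a::euclidean_space \<Rightarrow> real"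
  assumes step: "\<And>x y. dist x y \<le> r0 \<Longrightarrow> \<bar>v x - v y\<bar> \<le> D"
    and far: "\<And>z. norm z \<ge> R \<Longrightarrow> v z = 0" and "r0 > 0" and n: "2 * R \<le> real n * r0"
    and x: "norm x \<le> R"
  shows "\<bar>v x\<bar> \<le> real n * D"
proof -
  obtain e :: 'a where e: "e \<in> Basis" using nonempty_Basis by blast
  have chain: "\<bar>v x - v (x + (real k * r0) *\<^sub>R e)\<bar> \<le> real k * D" for k
  proof (induction k)
    case (Suc k)
    have "dist (x + (real k * r0) *\<^sub>R e) (x + (real (Suc k) * r0) *\<^sub>R e) = norm (r0 *\<^sub>R e)"
      by (simp add: dist_norm algebra_simps norm_minus_commute)
    also have "\<dots> = r0" using e \<open>r0 > 0\<close> by simp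
    finally show ?case using step[of "x + (real k * r0) *\<^sub>R e" "x + (real (Suc k) * r0) *\<^sub>R e"] Suc
      by (simp add: algebra_simps)
  qed simp
  have "norm ((real n * r0) *\<^sub>R e) - norm x \<le> norm (x + (real n * r0) *\<^sub>R e)"
    by (metis add.commute norm_diff_ineq)
  moreover have "norm ((real n * r0) *\<^sub>R e) = real n * r0" using e \<open>r0 > 0\<close> by simp
  ultimately have "R \<le> norm (x + (real n * r0) *\<^sub>R e)" using n x by linarith
  from far[OF this] chain[of n] show ?thesis by simp
qed

text \<open>
  Ball means at radii up to \<open>1/6\<close> satisfy the oscillation bound with \<open>D = K * W_norm s p u\<close>. The
  representative comes with its description as a limit of ball means, from which its vanishing at
  every point far from the support of \<open>u\<close> can be read off.
\<close>
lemma Holder_representative_local: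
  assumes "0 < s" "s < 1" "1 < p" "real DIM('a) < s * p"
  shows "\<exists>L\<ge>0. \<forall>u :: 'a::euclidean_space \<Rightarrow> real.
     u \<in> borel_measurable borel \<longrightarrow> (\<integral>\<^sup>+x. ennreal (\<bar>u x\<bar> powr p) \<partial>lborel) < \<infinity> \<longrightarrow>
     W_energy s p u < \<infinity> \<longrightarrow>
     (\<exists>v. (\<forall>x. (\<lambda>k. ball_mean u x (1/6 / 2 ^ k)) \<longlonglongrightarrow> v x) \<and> (AE x in lborel. u x = v x) \<and>
       (\<forall>x y. dist x y \<le> 1/6 \<longrightarrow>
          \<bar>v x - v y\<bar> \<le> L * W_norm s p u * dist x y powr (s - real DIM('a) / p)))"
proof -
  define \<beta> where "\<beta> = s - real DIM('a) / p"
  have "\<beta> > 0" using assms by (simp add: \<beta>_def field_simps)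
  obtain K where "K \<ge> 0" and K: "\<And>(u :: 'a \<Rightarrow> real) x y r \<rho>. \<lbrakk>u \<in> borel_measurable borel;
      (\<integral>\<^sup>+x. ennreal (\<bar>u x\<bar> powr p) \<partial>lborel) < \<infinity>; W_energy s p u < \<infinity>;
      0 < \<rho>; \<rho> \<le> r; r \<le> 2 * \<rho>; r \<le> 1/6; dist x y \<le> r\<rbrakk> \<Longrightarrow>
      \<bar>ball_mean u x r - ball_mean u y \<rho>\<bar> \<le> K * W_norm s p u * r powr \<beta>"
    using ball_mean_oscillation[OF assms(1-3), where 'a='a] unfolding \<beta>_def by blast
  define c where "c = (1 + 2 / (1 - 2 powr - \<beta>)) * 2 powr \<beta>"
  have "c \<ge> 0" using \<open>\<beta> > 0\<close> powr_less_one[of 2 "- \<beta>"] by (simp add: c_def)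
  have "\<exists>v. (\<forall>x. (\<lambda>k. ball_mean u x (1/6 / 2 ^ k)) \<longlonglongrightarrow> v x) \<and> (AE x in lborel. u x = v x) \<and>
       (\<forall>x y. dist x y \<le> 1/6 \<longrightarrow> \<bar>v x - v y\<bar> \<le> c * K * W_norm s p u * dist x y powr \<beta>)"
    if u: "u \<in> borel_measurable borel"
      and up: "(\<integral>\<^sup>+x. ennreal (\<bar>u x\<bar> powr p) \<partial>lborel) < \<infinity>" and E: "W_energy s p u < \<infinity>"
    for u :: "'a \<Rightarrow> real"
  proof -
    have e: "W_norm s p u \<ge> 0" by (simp add: W_norm_def)
    obtain v where v: "\<And>x. (\<lambda>k. ball_mean u x (1/6 / 2 ^ k)) \<longlonglongrightarrow> v x"
      and Hv: "\<And>x y. dist x y \<le> 1/6 \<Longrightarrow>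
        \<bar>v x - v y\<bar> \<le> c * (K * W_norm s p u) * dist x y powr \<beta>"
      using mean_oscillation_imp_Holder[of "1/6" "ball_mean u" "K * W_norm s p u" \<beta>] K[OF u up E] \<open>K \<ge> 0\<close> e \<open>\<beta> > 0\<close>
      unfolding c_def by (metis mult_nonneg_nonneg zero_less_divide_1_iff zero_less_numeral)
    have lim0: "filterlim (\<lambda>k. 1/6 / 2 ^ k :: real) (at_right 0) sequentially"
      by real_asymp
    have "AE x in lborel. u x = v x"
      using ball_mean_tendsto_AE[OF assms(1-3) u up E]
    proof (rule eventually_mono)
      fix x assume "(ball_mean u x \<longlongrightarrow> u x) (at_right 0)"
      from filterlim_compose[OF this lim0] v[of x] show "u x = v x"
        by (rule LIMSEQ_unique)
    qed
    with v Hv show ?thesis by (auto simp: mult_ac)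
  qed
  then show ?thesis
    using \<open>c \<ge> 0\<close> \<open>K \<ge> 0\<close> unfolding \<beta>_def by (intro exI[of _ "c * K"]) auto
qed

text \<open>
  Beyond distance \<open>r0\<close> the Hoelder quotient is at most \<open>2 sup \<bar>v\<bar> / r0\<^sup>\<beta>\<close>, and the chain of \<open>n\<close>
  steps bounds \<open>sup \<bar>v\<bar>\<close> by \<open>n D r0\<^sup>\<beta>\<close>; the powers of \<open>r0\<close> cancel.
\<close>
lemma locally_Holder_vanishing_far:
  fixes v :: "'a::euclidean_space \<Rightarrow> real"
  assumes hol: "\<And>x y. dist x y \<le> r0 \<Longrightarrow> \<bar>v x - v y\<bar> \<le> D * dist x y powr \<beta>"
    and far: "\<And>z. norm z \<ge> R \<Longrightarrow> v z = 0"
    and "r0 > 0" "\<beta> > 0" "D \<ge> 0" and n: "2 * R \<le> real n * r0"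
  shows "\<bar>v x\<bar> \<le> real n * r0 powr \<beta> * D"
    and "\<bar>v x - v y\<bar> \<le> (1 + 2 * real n) * D * dist x y powr \<beta>"
    and "continuous_on UNIV v"
proof -
  have bd: "\<bar>v x\<bar> \<le> real n * (D * r0 powr \<beta>)" for x
  proof (cases "norm x \<le> R")
    case True
    have "\<bar>v x - v y\<bar> \<le> D * r0 powr \<beta>" if "dist x y \<le> r0" for x y
    proof -
      have "D * dist x y powr \<beta> \<le> D * r0 powr \<beta>"
        using that assms by (intro mult_left_mono powr_mono2) auto
      then show ?thesis using hol[OF that] by linarith
    qed
    from vanishing_far_imp_bounded[of r0 v, OF this far \<open>r0 > 0\<close> n True] show ?thesis by simp
  qed (use far[of x] \<open>D \<ge> 0\<close> in auto)
  then show "\<bar>v x\<bar> \<le> real n * r0 powr \<beta> * D" by (simp add: mult_ac)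
  show "\<bar>v x - v y\<bar> \<le> (1 + 2 * real n) * D * dist x y powr \<beta>"
  proof (cases "dist x y \<le> r0")
    case True
    have "1 * (D * dist x y powr \<beta>) \<le> (1 + 2 * real n) * (D * dist x y powr \<beta>)"
      using \<open>D \<ge> 0\<close> by (intro mult_right_mono) auto
    then show ?thesis using hol[OF True] by (simp add: mult.assoc)
  next
    case False
    have "\<bar>v x - v y\<bar> \<le> 2 * real n * D * r0 powr \<beta>"
      using bd[of x] bd[of y] by (simp add: mult.assoc)
    also have "\<dots> \<le> (1 + 2 * real n) * D * dist x y powr \<beta>"
      using False assms by (intro mult_mono powr_mono2) (auto intro: mult_right_mono)
    finally show ?thesis .
  qed
  show "continuous_on UNIV v"
    unfolding continuous_on_def
  proof
    fix x :: 'a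
    have lim: "((\<lambda>y. D * dist y x powr \<beta>) \<longlongrightarrow> D * dist x x powr \<beta>) (at x)"
      using \<open>\<beta> > 0\<close> by (intro tendsto_intros tendsto_powr') auto
    have ev: "\<forall>\<^sub>F y in at x. norm (v y - v x) \<le> D * dist y x powr \<beta>"
      unfolding eventually_at using \<open>r0 > 0\<close> hol by (intro exI[of _ r0]) auto
    have "((\<lambda>y. v y - v x) \<longlongrightarrow> 0) (at x)"
      by (rule Lim_null_comparison[OF ev]) (use lim in simp)
    then show "(v \<longlongrightarrow> v x) (at x within UNIV)" by (simp add: LIM_zero_iff)
  qed
qed

section \<open>The embedding\<close>

lemma ball_mean_eq_0:
  assumes "AE x in lborel. x \<notin> \<Omega> \<longrightarrow> u x = 0" and "ball z r \<inter> \<Omega> = {}"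
  shows "ball_mean u z r = 0"
proof -
  have "AE y in uniform_measure lborel (ball z r). u y = 0"
    using assms(1) by (intro AE_uniform_measureI) (use assms(2) in \<open>auto elim!: eventually_mono\<close>)
  then show ?thesis unfolding ball_mean_def by (rule integral_eq_zero_AE)
qed

lemma Holder_norm_le:
  assumes "continuous_on UNIV v" and "\<And>x. \<bar>v x\<bar> \<le> A"
    and "\<And>x y. \<bar>v x - v y\<bar> \<le> B * dist x y powr \<beta>"
  shows "Holder_norm \<beta> (\<Omega> :: 'a::euclidean_space set) v \<le> ennreal (A + B)"
proof -
  have "A \<ge> 0" using assms(2)[of 0] by simp
  obtain b :: 'a where b: "b \<in> Basis" using nonempty_Basis by blast
  have "B \<ge> 0" using assms(3)[of 0 b] b by simp
  have [measurable]: "v \<in> borel_measurable (lebesgue_on \<Omega>)"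
    using borel_measurable_continuous_onI[OF assms(1)]
    by (intro measurable_restrict_space1 measurable_completion) simp
  have "esssup (lebesgue_on \<Omega>) (\<lambda>x. ennreal \<bar>v x\<bar>) \<le> ennreal A"
    using assms(2) by (intro esssup_I) (auto intro: ennreal_leI)
  moreover have "(SUP (x, y)\<in>{(x, y). x \<in> \<Omega> \<and> y \<in> \<Omega> \<and> x \<noteq> y}.
      ennreal (\<bar>v x - v y\<bar> / norm (x - y) powr \<beta>)) \<le> ennreal B"
    using assms(3) by (intro SUP_least) (auto intro!: ennreal_leI simp: dist_norm divide_le_eq)
  ultimately show ?thesis
    unfolding Holder_norm_def using \<open>A \<ge> 0\<close> \<open>B \<ge> 0\<close> by (simp add: add_mono)
qed

theorem theorem4p2:
  fixes \<Omega> :: "'a::euclidean_space set" and s p \<beta> :: real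
  assumes "1 < p" and "0 < s" and "s < 1"
    and "is_domain \<Omega>" and "bounded \<Omega>" and "Lipschitz_boundary \<Omega>"
    and "s * p > real DIM('a)"
    and "\<beta> = s - real DIM('a) / p"
  shows "\<beta> \<in> {0<..<1} \<and>
    continuously_embedded \<Omega> (W_space s p \<Omega>) (W_norm s p) (Holder_space \<beta> \<Omega>) (Holder_norm \<beta> \<Omega>)"
proof
  have "0 < real DIM('a) / p" using \<open>1 < p\<close> by (intro divide_pos_pos) auto
  moreover have "real DIM('a) / p < s" using assms by (simp add: divide_less_eq)
  ultimately have "\<beta> > 0" "\<beta> < 1" using \<open>s < 1\<close> \<open>\<beta> = _\<close> by linarith+
  then show "\<beta> \<in> {0<..<1}" by simp
  obtain L where "L \<ge> 0" and L: "\<And>u :: 'a \<Rightarrow> real. \<lbrakk>u \<in> borel_measurable borel;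
      (\<integral>\<^sup>+x. ennreal (\<bar>u x\<bar> powr p) \<partial>lborel) < \<infinity>; W_energy s p u < \<infinity>\<rbrakk> \<Longrightarrow>
     \<exists>v. (\<forall>x. (\<lambda>k. ball_mean u x (1/6 / 2 ^ k)) \<longlonglongrightarrow> v x) \<and> (AE x in lborel. u x = v x) \<and>
       (\<forall>x y. dist x y \<le> 1/6 \<longrightarrow> \<bar>v x - v y\<bar> \<le> L * W_norm s p u * dist x y powr \<beta>)"
    using Holder_representative_local[OF \<open>0 < s\<close> \<open>s < 1\<close> \<open>1 < p\<close> \<open>s * p > real DIM('a)\<close>]
    unfolding \<open>\<beta> = _\<close> by blast
  obtain R where R: "\<And>x. x \<in> \<Omega> \<Longrightarrow> norm x \<le> R"
    using \<open>bounded \<Omega>\<close> by (auto simp: bounded_iff)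
  \<comment> \<open>With steps of length \<open>1/6\<close>, \<open>n\<close> of them cover the diameter \<open>2 (R + 1)\<close> of a ball outside of
    which all balls of radius at most \<open>1/6\<close> miss \<open>\<Omega>\<close>.\<close>
  define n where "n = nat \<lceil>12 * (R + 1)\<rceil>"
  define C where "C = (real n * (1/6) powr \<beta> + (1 + 2 * real n)) * L"
  have n: "2 * (R + 1) \<le> real n * (1/6)" unfolding n_def by linarith
  have "\<exists>v\<in>Holder_space \<beta> \<Omega>. (AE x in lebesgue. x \<in> \<Omega> \<longrightarrow> u x = v x) \<and>
      Holder_norm \<beta> \<Omega> v \<le> ennreal (C * W_norm s p u)" if u: "u \<in> W_space s p \<Omega>" for u
  proof -
    obtain w where w [measurable]: "w \<in> borel_measurable lborel" and uw: "AE x in lborel. u x = w x"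
      using u completion_ex_borel_measurable_real[of u lborel] by (auto simp: W_space_def)
    have E: "W_energy s p u = W_energy s p w" by (rule W_energy_cong_AE[OF uw])
    have "(\<integral>\<^sup>+x. ennreal (\<bar>w x\<bar> powr p) \<partial>lborel) = (\<integral>\<^sup>+x. ennreal (\<bar>u x\<bar> powr p) \<partial>lebesgue)"
      unfolding nn_integral_completion using uw by (intro nn_integral_cong_AE) (auto elim!: eventually_mono)
    also have "\<dots> < \<infinity>" using u by (simp add: W_space_def integrable_iff_bounded)
    finally obtain v where v: "\<And>x. (\<lambda>k. ball_mean w x (1/6 / 2 ^ k)) \<longlonglongrightarrow> v x"
      and wv: "AE x in lborel. w x = v x"
      and hol: "\<And>x y. dist x y \<le> 1/6 \<Longrightarrow> \<bar>v x - v y\<bar> \<le> L * W_norm s p w * dist x y powr \<beta>"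
      using L[of w] w u E by (auto simp: W_space_def)
    have "AE x in lborel. x \<notin> \<Omega> \<longrightarrow> u x = 0"
      using u by (auto simp: W_space_def AE_completion_iff)
    then have w0: "AE x in lborel. x \<notin> \<Omega> \<longrightarrow> w x = 0"
      using uw by eventually_elim auto
    have far: "v z = 0" if "norm z \<ge> R + 1" for z
    proof -
      have "ball_mean w z (1/6 / 2 ^ k) = 0" for k :: nat
      proof (rule ball_mean_eq_0[OF w0])
        have "(1::real) \<le> 2 ^ k" by simp
        then have "1/6 / 2 ^ k \<le> (1/6::real)" by (simp add: divide_le_eq)
        then show "ball z (1/6 / 2 ^ k) \<inter> \<Omega> = {}"
        proof (intro equals0I)
          fix x assume "x \<in> ball z (1/6 / 2 ^ k) \<inter> \<Omega>"
          then have "dist z x < 1/6 / 2 ^ k" "norm x \<le> R"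
            using R by auto
          with \<open>1/6 / 2 ^ k \<le> 1/6\<close> that norm_triangle_ineq2[of z x] show False
            unfolding dist_norm by linarith
        qed
      qed
      then show ?thesis using v[of z] by (simp add: LIMSEQ_const_iff)
    qed
    let ?e = "W_norm s p w"
    have "L * ?e \<ge> 0" using \<open>L \<ge> 0\<close> by (simp add: W_norm_def)
    note vH = locally_Holder_vanishing_far[of "1/6" v, OF hol far _ \<open>\<beta> > 0\<close> this n, simplified]
    have "Holder_norm \<beta> \<Omega> v
        \<le> ennreal (real n * (1/6) powr \<beta> * (L * ?e) + (1 + 2 * real n) * (L * ?e))"
      using vH by (intro Holder_norm_le) auto
    also have "real n * (1/6) powr \<beta> * (L * ?e) + (1 + 2 * real n) * (L * ?e) = C * W_norm s p u"
      by (simp add: C_def W_norm_def E algebra_simps)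
    finally have "Holder_norm \<beta> \<Omega> v \<le> ennreal (C * W_norm s p u)" .
    moreover from this have "v \<in> Holder_space \<beta> \<Omega>"
      using vH(3) by (auto simp: Holder_space_def intro: continuous_on_subset le_less_trans)
    moreover have "AE x in lborel. x \<in> \<Omega> \<longrightarrow> u x = v x"
      using uw wv by eventually_elim auto
    then have "AE x in lebesgue. x \<in> \<Omega> \<longrightarrow> u x = v x" by (rule AE_completion)
    ultimately show ?thesis by blast
  qed
  moreover have "C \<ge> 0" using \<open>L \<ge> 0\<close> by (simp add: C_def)
  ultimately show "continuously_embedded \<Omega> (W_space s p \<Omega>) (W_norm s p) (Holder_space \<beta> \<Omega>) (Holder_norm \<beta> \<Omega>)"
    unfolding continuously_embedded_def by blast
qed

end
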